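(* Let $T_r := r(r+1)/2$ denote the $r$th triangular number. If $n\ge 1$ is an integer with $n\ne T_r+1$ for every integer $r\ge 0$, then $$D_3^{(0)}(n)=D_3^{(1)}(n)=D_3^{(2)}(n)=\frac{D_3(n)}{3}.$$
   Context: A partition is a weakly decreasing finite list of nonnegative integers; its weight is the sum of its parts. For a positive integer $n$, $\mathcal D_3(n)$ is the set of partitions $\mu$ of weight $n$ into nonnegative parts (parts equal to $0$ are allowed and count as parts) such that (i) the smallest part of $\mu$ occurs exactly three times, and (ii) every part strictly larger than the smallest part occurs at most twice. (So such a partition has either no zero parts or exactly three zero parts.) Put $D_3(n):=|\mathcal D_3(n)|$. For $\mu\in\mathcal D_3(n)$, let $\tau(\mu)$ be the number of parts of $\mu$ (counted with multiplicity) strictly larger than its smallest part. For $i\in\{0,1,2\}$ let $\mathcal D_3^{(i)}(n):=\{\mu\in\mathcal D_3(n):\tau(\mu)\equiv i \pmod 3\}$ and $D_3^{(i)}(n):=|\mathcal D_3^{(i)}(n)|$. *)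

theory Defs
  imports Complex_Main "HOL-Number_Theory.Cong"
begin

definition triangular :: "nat \<Rightarrow> nat" where
  "triangular r = r * (r + 1) div 2"

definition is_partition :: "nat list \<Rightarrow> bool" where
  "is_partition \<mu> \<longleftrightarrow> sorted_wrt (\<ge>) \<mu>"

definition smallest_part :: "nat list \<Rightarrow> nat" where
  "smallest_part \<mu> = Min (set \<mu>)"

text \<open>Zero entries of the list are genuine parts. The condition \<open>\<mu> \<noteq> []\<close> is only there because
  the empty list has no smallest part.\<close>

definition partitions_D3 :: "nat \<Rightarrow> nat list set" where
  "partitions_D3 n = {\<mu>. is_partition \<mu> \<and> sum_list \<mu> = n \<and> \<mu> \<noteq> [] \<and>
     count_list \<mu> (smallest_part \<mu>) = 3 \<and>
     (\<forall>x \<in> set \<mu>. x > smallest_part \<mu> \<longrightarrow> count_list \<mu> x \<le> 2)}"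

definition D3 :: "nat \<Rightarrow> nat" where
  "D3 n = card (partitions_D3 n)"

definition tau :: "nat list \<Rightarrow> nat" where
  "tau \<mu> = length (filter (\<lambda>x. x > smallest_part \<mu>) \<mu>)"

definition partitions_D3_class :: "nat \<Rightarrow> nat \<Rightarrow> nat list set" where
  "partitions_D3_class i n = {\<mu> \<in> partitions_D3 n. [tau \<mu> = i] (mod 3)}"

definition D3_class :: "nat \<Rightarrow> nat \<Rightarrow> nat" where
  "D3_class i n = card (partitions_D3_class i n)"

text \<open>Although zero parts are allowed, there are only finitely many of these partitions, so the
  cardinalities above are genuine counts.\<close>

lemma length_le_count_list_zero_plus_sum_list:
  "length \<mu> \<le> count_list \<mu> 0 + sum_list (\<mu> :: nat list)"
  by (induction \<mu>) auto

lemma finite_partitions_D3: "finite (partitions_D3 n)"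
proof (rule finite_subset)
  show "finite {xs. set xs \<subseteq> {..n} \<and> length xs \<le> n + 3}"
    by (rule finite_lists_length_le) simp
  show "partitions_D3 n \<subseteq> {xs. set xs \<subseteq> {..n} \<and> length xs \<le> n + 3}"
  proof
    fix \<mu> assume \<mu>: "\<mu> \<in> partitions_D3 n"
    have "count_list \<mu> 0 \<le> 3"
    proof (cases "0 \<in> set \<mu>")
      case True
      then have "Min (set \<mu>) \<le> 0"
        by (intro Min_le) auto
      then show ?thesis
        using \<mu> by (simp add: partitions_D3_def smallest_part_def)
    qed (simp add: count_list_0_iff)
    moreover have "sum_list \<mu> = n"
      using \<mu> by (simp add: partitions_D3_def)
    ultimately show "\<mu> \<in> {xs. set xs \<subseteq> {..n} \<and> length xs \<le> n + 3}"
      using length_le_count_list_zero_plus_sum_list[of \<mu>] member_le_sum_list[of _ \<mu>] by auto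
  qed
qed

lemma finite_partitions_D3_class: "finite (partitions_D3_class i n)"
  by (simp add: partitions_D3_class_def finite_partitions_D3)

end

theory Submission
  imports Defs "HOL-Computational_Algebra.Formal_Power_Series"
begin

text \<open>For a primitive cube root of unity \<open>w\<close>, the three classes have equal size iff the coefficient
  of \<open>q\<^sup>n\<close> in \<open>F\<^sub>3\<close> vanishes, where
  \<open>F\<^sub>k = (\<Sum>m\<ge>0. q\<^bsup>km\<^esup> (\<Prod>j>m. 1 + w q\<^bsup>j\<^esup> + w\<^sup>2 q\<^bsup>2j\<^esup>))\<close>. Since \<open>1 + w + w\<^sup>2 = 0\<close>, splitting off the first
  factor of the products gives \<open>(1 - q\<^bsup>k\<^esup>) F\<^sub>k + w F\<^sub>k\<^sub>+\<^sub>1 + w\<^sup>2 F\<^sub>k\<^sub>+\<^sub>2 = 0\<close> for \<open>k \<ge> 1\<close> and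
  \<open>w F\<^sub>1 + w\<^sup>2 F\<^sub>2 = -1\<close>. With \<open>c = - w\<^sup>2\<close> and the triangular numbers \<open>T\<^sub>n\<close>, the series
  \<open>H\<^sub>k = (\<Sum>n\<ge>0. c\<^bsup>n\<^esup> q\<^bsup>T n\<^esup> (1 - q\<^bsup>n+1\<^esup>) \<cdots> (1 - q\<^bsup>n+k\<^esup>))\<close>
  satisfy the same recurrence, shifted by one. Both families converge as \<open>k\<close> grows, which forces
  \<open>F\<^sub>k\<^sub>+\<^sub>1 = H\<^sub>k\<close>. In \<open>H\<^sub>2\<close> the terms with exponent \<open>T\<^sub>n\<close> cancel because \<open>1 - c + c\<^sup>2 = 0\<close>, leaving
  only the exponents \<open>0\<close> and \<open>T\<^sub>n + 1\<close>. All sums are truncated at \<open>N\<close>, with error terms of order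
  beyond \<open>q\<^sup>N\<close>.\<close>

unbundle fps_syntax

section \<open>Triangular numbers, the two truncated families and their recurrences\<close>

lemma triangular_Suc: "triangular (Suc n) = triangular n + n + 1"
proof -
  have "Suc n * (Suc n + 1) = n * (n + 1) + (n + 1) * 2"
    by (simp add: algebra_simps)
  then have "triangular (Suc n) = (n * (n + 1) + (n + 1) * 2) div 2"
    by (simp only: triangular_def)
  then show ?thesis
    by (simp only: triangular_def) simp
qed

lemma le_triangular: "n \<le> triangular n"
  by (induction n) (auto simp: triangular_Suc)

text \<open>\<open>m\<close> is the smallest part, occurring \<open>k\<close> times; the factor at
  \<open>j\<close> lets a larger part \<open>j\<close> occur up to twice, each copy marked by
  \<open>w\<close>. As \<open>q\<close> is any ring element, the recurrences are polynomial
  identities; \<open>fps_X\<close> is substituted only to compare coefficients.\<close>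

definition D3_series :: "'a::comm_ring_1 \<Rightarrow> 'a \<Rightarrow> nat \<Rightarrow> nat \<Rightarrow> 'a" where
  "D3_series q w N k =
     (\<Sum>m\<le>N. q ^ (k * m) * (\<Prod>j\<in>{m<..N}. 1 + w * q ^ j + w^2 * q ^ (2 * j)))"

definition theta_sum :: "'a::comm_ring_1 \<Rightarrow> 'a \<Rightarrow> nat \<Rightarrow> nat \<Rightarrow> 'a" where
  "theta_sum q c N k = (\<Sum>n<N. c ^ n * q ^ triangular n * (\<Prod>j<k. 1 - q ^ (n + 1 + j)))"

lemma D3_series_0: "D3_series q w 0 k = 1"
  by (simp add: D3_series_def)

text \<open>The factor at \<open>Suc N\<close> enters every old summand; the new summand
  \<open>m = Suc N\<close> has an empty product.\<close>

lemma D3_series_Suc: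
  "D3_series q w (Suc N) k =
     (1 + w * q ^ Suc N + w^2 * q ^ (2 * Suc N)) * D3_series q w N k + q ^ (k * Suc N)"
proof -
  have "{m<..Suc N} = insert (Suc N) {m<..N}" if "m \<le> N" for m
    using that by auto
  then show ?thesis
    unfolding D3_series_def sum.atMost_Suc sum_distrib_left
    by (intro arg_cong2[where f = "(+)"] sum.cong) (simp_all add: mult_ac)
qed

text \<open>Induction on \<open>N\<close>, adding the last factor. For \<open>k \<ge> 1\<close> the
  right-hand side is the truncation error; for \<open>k = 0\<close> it is \<open>-1\<close>, which
  is the initial relation.\<close>

lemma D3_series_rec:
  assumes w: "1 + w + w^2 = (0::'a::comm_ring_1)"
  shows "(1 - q ^ k) * D3_series q w N k + w * D3_series q w N (k + 1)
           + w^2 * D3_series q w N (k + 2) = - (q ^ (k * (N + 1)))"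
proof (induction N)
  case 0
  then show ?case using w by (simp add: D3_series_0 algebra_simps)
next
  case (Suc N)
  define x y where "x = q ^ k" and "y = q ^ Suc N"
  define z where "z = q ^ (k * Suc N)"
  define f where "f = 1 + w * y + w^2 * y^2"
  have y2: "q ^ (2 * Suc N) = y^2" "q ^ ((k + 1) * Suc N) = z * y" "q ^ ((k + 2) * Suc N) = z * y^2"
    "q ^ (k * (Suc N + 1)) = z * x"
    unfolding x_def y_def z_def power_mult[symmetric] power_add[symmetric]
    by (rule arg_cong[where f = "(^) q"], simp add: algebra_simps)+
  have IH: "(1 - x) * D3_series q w N k + w * D3_series q w N (k + 1)
           + w^2 * D3_series q w N (k + 2) = - z"
    using Suc by (simp add: x_def z_def)
  \<comment> \<open>The three series are multiplied by \<open>f\<close> and gain \<open>z\<close>,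
    \<open>z * y\<close> and \<open>z * y^2\<close>; the weighted gains add up to
    \<open>z * (f - x)\<close>.\<close>
  have "(1 - x) * D3_series q w (Suc N) k + w * D3_series q w (Suc N) (k + 1)
           + w^2 * D3_series q w (Suc N) (k + 2)
      = f * ((1 - x) * D3_series q w N k + w * D3_series q w N (k + 1)
           + w^2 * D3_series q w N (k + 2)) + z * (f - x)"
    unfolding D3_series_Suc y2 f_def y_def[symmetric] z_def[symmetric]
    by (simp add: algebra_simps)
  also have "\<dots> = - (z * x)"
    unfolding IH by (simp add: algebra_simps)
  finally show ?case unfolding y2 x_def .
qed

text \<open>For \<open>c = - (w^2)\<close> with \<open>1 + w + w^2 = 0\<close>, the coefficients
  \<open>c - 1\<close> and \<open>- c\<close> become \<open>w\<close> and \<open>w^2\<close>, as in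
  \<open>D3_series_rec\<close> at \<open>k + 1\<close>. The right-hand side is the truncation
  error.\<close>

lemma theta_sum_rec:
  "(1 - q ^ (k + 1)) * theta_sum q c N k + (c - 1) * theta_sum q c N (k + 1)
     - c * theta_sum q c N (k + 2)
   = c ^ N * q ^ (triangular N + k + 1) * (1 - q ^ N) * (\<Prod>j<k. 1 - q ^ (N + 1 + j))"
proof (induction N)
  case 0
  then show ?case by (simp add: theta_sum_def)
next
  case (Suc N)
  define x y b where "x = q ^ (k + 1)" and "y = q ^ N" and "b = (\<Prod>j<k. 1 - q ^ (N + 1 + j))"
  define t where "t = c ^ N * q ^ triangular N"
  \<comment> \<open>Both sides are the product of \<open>1 - q ^ i\<close> for \<open>i\<close> from
    \<open>N + 1\<close> to \<open>N + k + 1\<close>, split at opposite ends.\<close>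
  have shift: "(1 - q ^ Suc N) * (\<Prod>j<k. 1 - q ^ (Suc N + 1 + j)) = b * (1 - y * x)"
  proof -
    have "(1 - q ^ Suc N) * (\<Prod>j<k. 1 - q ^ (Suc N + 1 + j)) = (\<Prod>j<Suc k. 1 - q ^ (N + 1 + j))"
      by (subst prod.lessThan_Suc_shift) simp
    also have "\<dots> = b * (1 - y * x)"
      by (simp add: b_def y_def x_def power_add mult_ac)
    finally show ?thesis .
  qed
  have st: "theta_sum q c (Suc N) k = theta_sum q c N k + t * b"
    "theta_sum q c (Suc N) (k + 1) = theta_sum q c N (k + 1) + t * b * (1 - y * x)"
    "theta_sum q c (Suc N) (k + 2) = theta_sum q c N (k + 2) + t * b * (1 - y * x) * (1 - q * y * x)"
    by (simp_all add: theta_sum_def t_def b_def y_def x_def power_add mult_ac)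
  have "c ^ Suc N * q ^ (triangular (Suc N) + k + 1) * (1 - q ^ Suc N) * (\<Prod>j<k. 1 - q ^ (Suc N + 1 + j))
     = c ^ Suc N * q ^ (triangular (Suc N) + k + 1) * (b * (1 - y * x))"
    by (simp only: shift mult.assoc)
  also have "\<dots> = t * c * (q * y * x) * (b * (1 - y * x))"
    by (simp add: triangular_Suc t_def y_def x_def power_add mult_ac)
  finally have rhs: "c ^ Suc N * q ^ (triangular (Suc N) + k + 1) * (1 - q ^ Suc N) *
      (\<Prod>j<k. 1 - q ^ (Suc N + 1 + j)) = t * c * (q * y * x) * (b * (1 - y * x))" .
  have "c ^ N * q ^ (triangular N + k + 1) * (1 - q ^ N) * (\<Prod>j<k. 1 - q ^ (N + 1 + j))
      = t * x * (1 - y) * b"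
    by (simp add: t_def y_def x_def b_def power_add mult_ac)
  then have IH: "(1 - x) * theta_sum q c N k + (c - 1) * theta_sum q c N (k + 1)
     - c * theta_sum q c N (k + 2) = t * x * (1 - y) * b"
    using Suc by (simp add: x_def)
  have "(1 - x) * theta_sum q c (Suc N) k + (c - 1) * theta_sum q c (Suc N) (k + 1)
     - c * theta_sum q c (Suc N) (k + 2)
    = t * x * (1 - y) * b + (1 - x) * (t * b) + (c - 1) * (t * b * (1 - y * x))
      - c * (t * b * (1 - y * x) * (1 - q * y * x))"
    unfolding st IH[symmetric] by (simp add: algebra_simps)
  also have "\<dots> = t * c * (q * y * x) * (b * (1 - y * x))"
    by (simp add: algebra_simps)
  finally show ?case unfolding rhs x_def .
qed

text \<open>The \<open>n\<close>-th summand is \<open>c ^ Suc n * q ^ triangular (Suc n) - c ^ n * q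
  ^ triangular n\<close>, so the sum telescopes.\<close>

lemma theta_sum_initial:
  "(c - 1) * theta_sum q c N 0 - c * theta_sum q c N 1 = c ^ N * q ^ triangular N - 1"
proof (induction N)
  case (Suc N)
  have "(c - 1) * theta_sum q c (Suc N) 0 - c * theta_sum q c (Suc N) 1 =
     ((c - 1) * theta_sum q c N 0 - c * theta_sum q c N 1)
       + c ^ N * q ^ triangular N * ((c - 1) - c * (1 - q ^ Suc N))"
    by (simp add: theta_sum_def algebra_simps)
  also have "\<dots> = c ^ Suc N * q ^ triangular (Suc N) - 1"
    unfolding Suc by (simp add: triangular_Suc algebra_simps power_add)
  finally show ?case .
qed (simp add: theta_sum_def triangular_def)

text \<open>Expanding the two factors spreads summand n over the exponents T_n, T_(n+1), T_(n+1) + 1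
  and T_(n+2). For n \<ge> 2 the exponent T_n collects c^(n-2) (1 - c + c^2) = 0. The incomplete
  cases n = 0, 1 give \<open>1 + (c - 1) * q\<close>, and the cut at \<open>N\<close> leaves the
  terms with factor \<open>c ^ N\<close>.\<close>

lemma theta_sum_two:
  assumes c: "c^2 = c - (1::'a::comm_ring_1)"
  shows "theta_sum q c N 2 = 1 + (c - 1) * q
           - c ^ N * (q ^ triangular N + (c - 1) * q ^ triangular (Suc N))
           - (\<Sum>n<N. c ^ n * q ^ (triangular (Suc n) + 1))"
proof (induction N)
  case 0
  then show ?case by (simp add: theta_sum_def triangular_def)
next
  case (Suc N)
  define t y where "t = q ^ triangular N" and "y = q ^ Suc N"
  have tr: "q ^ triangular (Suc N) = t * y" "q ^ triangular (Suc (Suc N)) = t * y * y * q"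
    by (simp_all add: triangular_Suc t_def y_def power_add)
  have "theta_sum q c (Suc N) 2 = theta_sum q c N 2 + c ^ N * t * ((1 - y) * (1 - y * q))"
    by (simp add: theta_sum_def t_def y_def numeral_2_eq_2 mult_ac)
  also have "\<dots> = 1 + (c - 1) * q
           - c ^ Suc N * (t * y + (c - 1) * (t * y * y * q))
           - ((\<Sum>n<N. c ^ n * q ^ (triangular (Suc n) + 1)) + c ^ N * (t * y * q))
           + c ^ N * t * y * y * q * (1 - c + c^2)"
    unfolding Suc tr t_def[symmetric] by (simp add: algebra_simps power2_eq_square)
  also have "1 - c + c^2 = 0"
    using c by simp
  finally show ?case
    by (simp only: tr sum.lessThan_Suc power_add power_one_right mult_zero_right add_0_right)
qed

section \<open>Coefficient comparison of the two families\<close>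

text \<open>Only summands with \<open>m > 0\<close> depend on \<open>k\<close>, and in both series
  these are divisible by \<open>fps_X ^ k\<close>.\<close>

lemma D3_series_fps_stable:
  assumes "j < k"
  shows "D3_series fps_X w N (Suc k) $ j = D3_series fps_X w N k $ j"
  unfolding D3_series_def fps_sum_nth
proof (rule sum.cong)
  fix m :: nat
  let ?P = "\<Prod>j\<in>{m<..N}. 1 + w * fps_X ^ j + w^2 * fps_X ^ (2 * j)"
  show "(fps_X ^ (Suc k * m) * ?P) $ j = (fps_X ^ (k * m) * ?P) $ j"
  proof (cases m)
    case (Suc m')
    have "j < k * m" "j < Suc k * m"
      using assms by (simp_all add: Suc)
    then show ?thesis
      by (simp only: fps_X_power_mult_nth if_True)
  qed simp
qed simp

text \<open>The extra factor \<open>1 - fps_X ^ (n + 1 + k)\<close> changes each summand by a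
  multiple of \<open>fps_X ^ Suc k\<close>.\<close>

lemma theta_sum_fps_stable:
  assumes "j < k"
  shows "theta_sum fps_X c N (Suc k) $ j = theta_sum fps_X c N k $ j"
proof -
  have "theta_sum fps_X c N (Suc k) = theta_sum fps_X c N k -
      fps_X ^ Suc k * (\<Sum>n<N. fps_X ^ n * (c ^ n * fps_X ^ triangular n * (\<Prod>j<k. 1 - fps_X ^ (n + 1 + j))))"
    by (simp add: theta_sum_def sum_distrib_left algebra_simps power_add flip: sum_subtractf)
  then show ?thesis
    using assms by (simp only: fps_sub_nth fps_X_power_mult_nth) simp
qed

text \<open>Once the lower coefficients vanish, the \<open>j\<close>-th ones satisfy
  \<open>d\<^sub>k + w d\<^sub>k\<^sub>+\<^sub>1 + w\<^sup>2 d\<^sub>k\<^sub>+\<^sub>2 = 0\<close>. As \<open>w\<^sup>3 = 1\<close> they have period three in \<open>k\<close>, and being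
  eventually constant they are constant.\<close>

lemma fps_three_term_recurrence_zero:
  fixes D :: "nat \<Rightarrow> 'a::comm_ring_1 fps"
  assumes w: "1 + w + w^2 = 0"
    and rec: "\<And>k j. j \<le> N \<Longrightarrow> ((1 - fps_X ^ (k + 1)) * D k + fps_const w * D (k + 1)
          + fps_const (w^2) * D (k + 2)) $ j = 0"
    and init: "\<And>j. j \<le> N \<Longrightarrow> (D 0 + fps_const w * D 1) $ j = 0"
    and stable: "\<And>k j. j < k \<Longrightarrow> D (Suc k) $ j = D k $ j"
    and "j \<le> N"
  shows "D k $ j = 0"
  using \<open>j \<le> N\<close>
proof (induction j arbitrary: k rule: less_induct)
  case (less j)
  have "w^3 = w * (1 + w + w^2) - (1 + w + w^2) + 1"
    by (simp add: algebra_simps power2_eq_square power3_eq_cube)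
  then have w3: "w^3 = 1"
    by (simp add: w)
  have d: "D k $ j + w * D (k + 1) $ j + w^2 * D (k + 2) $ j = 0" for k
  proof -
    have "(fps_X ^ (k + 1) * D k) $ j = 0"
      unfolding fps_X_power_mult_nth using less by simp
    then show ?thesis
      using rec[of j k] less.prems by (simp add: left_diff_distrib)
  qed
  have per: "D (k + 3) $ j = D k $ j" for k
  proof -
    have "w^3 * D (k + 3) $ j - D k $ j =
       w * (D (k + 1) $ j + w * D (k + 2) $ j + w^2 * D (k + 3) $ j)
       - (D k $ j + w * D (k + 1) $ j + w^2 * D (k + 2) $ j)"
      by (simp add: algebra_simps power2_eq_square power3_eq_cube)
    also have "\<dots> = 0"
      using d[of k] d[of "k + 1"] by (simp add: eval_nat_numeral)
    finally show ?thesis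
      by (simp add: w3)
  qed
  have per': "D (k + 3 * i) $ j = D k $ j" for k i
    by (induction i) (use per[of "k + 3 * i" for i] in \<open>simp_all add: algebra_simps\<close>)
  have "D (Suc j + i) $ j = D (Suc j) $ j" for i
    by (induction i) (simp_all add: stable)
  then have const: "D k $ j = D (Suc j) $ j" for k
  proof -
    \<comment> \<open>A shift by a multiple of the period lands in the stable range.\<close>
    have "k + 3 * Suc j = Suc j + (k + 2 * Suc j)"
      by simp
    then show ?thesis
      using per'[of k "Suc j"] \<open>\<And>i. D (Suc j + i) $ j = D (Suc j) $ j\<close> by (simp only:)
  qed
  define e where "e = D (Suc j) $ j"
  have "e + w * e = 0"
    using init[of j] less.prems const[of 0] const[of 1] by (simp add: e_def)
  moreover have "e + w * e + w^2 * e = 0"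
    using d[of 0] by (simp only: add_0 const[of 0] const[of 1] const[of 2] e_def)
  \<comment> \<open>The initial relation removes all but \<open>w^2 * e\<close>, and
    \<open>w\<close> is a unit.\<close>
  ultimately have "w^2 * e = 0"
    by simp
  then have "w^3 * e = 0"
    by (simp add: power3_eq_cube power2_eq_square mult.assoc)
  then show ?case
    by (simp add: w3 const[of k] e_def)
qed

text \<open>The difference of the two sides meets the hypotheses of
  \<open>fps_three_term_recurrence_zero\<close>, as all truncation errors have order above
  \<open>N\<close>. The cut-off \<open>Suc N\<close> ensures this for the initial relation:
  \<open>triangular N\<close> can equal \<open>N\<close>.\<close>

lemma D3_series_eq_theta_sum:
  fixes w :: "'a::comm_ring_1"
  assumes w: "1 + w + w^2 = 0" and "j \<le> N"
  shows "D3_series fps_X (fps_const w) N (k + 1) $ j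
       = theta_sum fps_X (- fps_const (w^2)) (Suc N) k $ j"
proof -
  define W :: "'a fps" where "W = fps_const w"
  have W: "1 + W + W^2 = 0"
    using arg_cong[OF w, of fps_const]
    by (simp only: W_def fps_const_power fps_const_1_eq_1 fps_const_0_eq_0 flip: fps_const_add)
  have W1: "- (W^2) - 1 = W"
  proof -
    have "- (W^2) - 1 = W - (1 + W + W^2)"
      by simp
    then show ?thesis
      by (simp only: W diff_0_right)
  qed
  define F where "F = D3_series fps_X W N"
  define H where "H = theta_sum fps_X (- (W^2)) (Suc N)"
  define D where "D k = F (k + 1) - H k" for k
  have "D k $ j = 0"
  proof (rule fps_three_term_recurrence_zero[OF w _ _ _ \<open>j \<le> N\<close>])
    fix k j assume j: "j \<le> N"
    have tri: "N < triangular (Suc N)"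
      using le_triangular[of "Suc N"] by simp
    define G where "G = (- (W^2)) ^ Suc N * (1 - fps_X ^ Suc N) * (\<Prod>j<k. 1 - fps_X ^ (Suc N + 1 + j))"
    have G: "(1 - fps_X ^ (k + 1)) * H k + W * H (k + 1) + W^2 * H (k + 2)
        = fps_X ^ (triangular (Suc N) + k + 1) * G"
      using theta_sum_rec[of fps_X k "- (W^2)" "Suc N"]
      unfolding H_def[symmetric] W1 G_def mult_minus_left diff_minus_eq_add
      by (simp only: mult_ac)
    have "(1 - fps_X ^ (k + 1)) * F (k + 1) + W * F (k + 2) + W^2 * F (k + 3)
        = fps_X ^ ((k + 1) * (N + 1)) * (-1)"
      using D3_series_rec[OF W, of fps_X "k + 1" N] by (simp add: F_def eval_nat_numeral)
    then have "(1 - fps_X ^ (k + 1)) * D k + W * D (k + 1) + W^2 * D (k + 2)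
        = fps_X ^ ((k + 1) * (N + 1)) * (-1) - fps_X ^ (triangular (Suc N) + k + 1) * G"
      unfolding G[symmetric] by (simp add: D_def algebra_simps eval_nat_numeral)
    moreover have "j < (k + 1) * (N + 1)" "j < triangular (Suc N) + k + 1"
      using j tri by (simp_all add: algebra_simps)
    ultimately show "((1 - fps_X ^ (k + 1)) * D k + fps_const w * D (k + 1)
        + fps_const (w^2) * D (k + 2)) $ j = 0"
      unfolding fps_const_power[symmetric] W_def[symmetric]
      by (simp only: fps_sub_nth fps_X_power_mult_nth) simp
  next
    fix j assume j: "j \<le> N"
    have "N < triangular (Suc N)"
      using le_triangular[of "Suc N"] by simp
    have "W * (D 0 + W * D 1) = (W * F 1 + W^2 * F 2) - (W * H 0 + W^2 * H 1)"
      by (simp add: D_def algebra_simps power2_eq_square numeral_2_eq_2)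
    also have "W * F 1 + W^2 * F 2 = - 1"
      using D3_series_rec[OF W, of fps_X 0 N] by (simp add: F_def numeral_2_eq_2)
    also have "W * H 0 + W^2 * H 1 = (- (W^2)) ^ Suc N * fps_X ^ triangular (Suc N) - 1"
      using theta_sum_initial[of "- (W^2)" fps_X "Suc N"] unfolding H_def[symmetric] W1 by simp
    \<comment> \<open>\<open>W^2\<close> is the inverse of \<open>W\<close>, which reduces the
      initial relation to \<open>D 0 + W * D 1\<close>.\<close>
    finally have "W^2 * (W * (D 0 + W * D 1)) =
        fps_X ^ triangular (Suc N) * (- (W^2 * (- (W^2)) ^ Suc N))"
      by (simp add: algebra_simps)
    moreover have "W^3 = W * (1 + W + W^2) - (1 + W + W^2) + 1"
      by (simp add: algebra_simps power2_eq_square power3_eq_cube)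
    then have "W^3 = 1"
      by (simp only: W) simp
    then have "W^2 * (W * x) = x" for x
      by (simp add: power2_eq_square power3_eq_cube flip: mult.assoc)
    ultimately show "(D 0 + fps_const w * D 1) $ j = 0"
      unfolding W_def[symmetric] using j \<open>N < triangular (Suc N)\<close>
      by (simp only: fps_X_power_mult_nth) simp
  next
    fix k j :: nat assume "j < k"
    then show "D (Suc k) $ j = D k $ j"
      using D3_series_fps_stable[of j "Suc k" W N] theta_sum_fps_stable[of j k "- (W^2)" "Suc N"]
      by (simp add: D_def F_def H_def)
  qed
  then show ?thesis
    by (simp add: D_def F_def H_def W_def)
qed

text \<open>The identity at \<open>k = 2\<close> reduces this to \<open>theta_sum_two\<close>: the
  hypotheses exclude the exponents 0 and T_r + 1, and the cut-off terms have order above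
  \<open>n\<close>.\<close>

lemma D3_series_three_nth:
  fixes w :: "'a::comm_ring_1"
  assumes w: "1 + w + w^2 = 0" and "n \<ge> 1" and n: "\<And>r. n \<noteq> triangular r + 1"
  shows "D3_series fps_X (fps_const w) n 3 $ n = 0"
proof -
  define c where "c = - (w^2)"
  have "c = 1 + w"
    unfolding c_def using w by (metis add_eq_0_iff minus_minus)
  moreover have "(1 + w)^2 = (1 + w + w^2) + w"
    by (simp add: algebra_simps power2_eq_square)
  ultimately have "c^2 = c - 1"
    using w by simp
  then have c: "fps_const c ^ 2 = fps_const c - 1"
    by (simp add: fps_const_power flip: fps_const_sub)
  have "theta_sum fps_X (fps_const c) (Suc n) 2 $ n = 0"
  proof -
    have "n < triangular (Suc n)" "n < triangular (Suc (Suc n))"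
      using le_triangular[of "Suc n"] le_triangular[of "Suc (Suc n)"] by linarith+
    \<comment> \<open>The term \<open>(c - 1) * q\<close> has exponent 1 = T_0 + 1.\<close>
    moreover have "n \<noteq> 1"
      using n[of 0] by (simp add: triangular_def)
    moreover have "n - Suc 0 \<noteq> triangular r" for r
      using n[of r] \<open>n \<ge> 1\<close> by linarith
    ultimately show ?thesis
      unfolding theta_sum_two[OF c] using \<open>n \<ge> 1\<close>
      by (simp add: fps_sum_nth algebra_simps fps_const_power fps_X_power_nth)
  qed
  then show ?thesis
    using D3_series_eq_theta_sum[OF w, of n n 2] by (simp add: c_def)
qed

section \<open>Generating function of partitions with parts repeated at most twice\<close>

text \<open>These lists are the parts above a smallest part \<open>m\<close>; the bound
  \<open>N\<close> gives finiteness and an induction on the largest part.\<close>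

definition parts_at_most_twice :: "nat \<Rightarrow> nat \<Rightarrow> nat list set" where
  "parts_at_most_twice m N =
     {\<mu>. sorted_wrt (\<ge>) \<mu> \<and> set \<mu> \<subseteq> {m<..N} \<and> (\<forall>x. count_list \<mu> x \<le> 2)}"

lemma sorted_split_smallest:
  fixes \<mu> :: "'a::linorder list"
  assumes "sorted_wrt (\<ge>) \<mu>" and "\<And>x. x \<in> set \<mu> \<Longrightarrow> s \<le> x"
  shows "\<mu> = filter (\<lambda>x. x > s) \<mu> @ replicate (count_list \<mu> s) s"
  using assms
proof (induction \<mu>)
  case (Cons x \<mu>)
  then have IH: "\<mu> = filter (\<lambda>x. x > s) \<mu> @ replicate (count_list \<mu> s) s"
    by simp
  show ?case
  proof (cases "x = s")
    case True
    then have "filter (\<lambda>x. x > s) \<mu> = []"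
      using Cons.prems by (auto simp: filter_empty_conv)
    then show ?thesis
      using IH True by simp
  next
    case False
    then have "s < x"
      using Cons.prems by (simp add: less_le)
    then show ?thesis
      using IH False by simp
  qed
qed simp

lemma sorted_split_largest:
  fixes \<mu> :: "'a::linorder list"
  assumes "sorted_wrt (\<ge>) \<mu>" and "\<And>x. x \<in> set \<mu> \<Longrightarrow> x \<le> M"
  shows "\<mu> = replicate (count_list \<mu> M) M @ filter (\<lambda>x. x < M) \<mu>"
  using assms
proof (induction \<mu>)
  case (Cons x \<mu>)
  then have IH: "\<mu> = replicate (count_list \<mu> M) M @ filter (\<lambda>x. x < M) \<mu>"
    by simp
  show ?case
  proof (cases "x = M")
    case True
    then show ?thesis
      using IH by simp
  next
    case False
    then have "x < M"
      using Cons.prems by (simp add: less_le)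
    then have "M \<notin> set \<mu>"
      using Cons.prems by auto
    then show ?thesis
      using IH \<open>x < M\<close> by (simp add: count_list_0_iff)
  qed
qed simp

lemma count_list_filter: "count_list (filter P xs) x = (if P x then count_list xs x else 0)"
  by (induction xs) auto

lemma count_list_replicate: "count_list (replicate k x) y = (if x = y then k else 0)"
  by (induction k) auto

text \<open>The multiplicity 0, 1 or 2 of the new size \<open>Suc N\<close> corresponds to the three
  summands of the new factor of the product.\<close>

lemma bij_betw_prepend_largest:
  assumes "m \<le> N"
  shows "bij_betw (\<lambda>(k, \<mu>). replicate k (Suc N) @ \<mu>) ({..2} \<times> parts_at_most_twice m N)
           (parts_at_most_twice m (Suc N))"
proof (rule bij_betw_byWitness[where f' = "\<lambda>\<mu>. (count_list \<mu> (Suc N), filter (\<lambda>x. x < Suc N) \<mu>)"],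
    goal_cases)
  have *: "count_list \<mu> (Suc N) = 0" "filter (\<lambda>x. x < Suc N) \<mu> = \<mu>"
    if "\<mu> \<in> parts_at_most_twice m N" for \<mu>
    using that by (auto simp: parts_at_most_twice_def filter_id_conv count_list_0_iff)
  {
    case 1
    then show ?case
      using * by (auto simp: count_list_replicate)
  next
    case 2
    then show ?case
      by (auto simp: parts_at_most_twice_def intro!: sorted_split_largest[symmetric])
  next
    case 3
    have "replicate k (Suc N) @ \<mu> \<in> parts_at_most_twice m (Suc N)"
      if "k \<le> 2" and \<mu>: "\<mu> \<in> parts_at_most_twice m N" for k \<mu>
    proof -
      have "sorted_wrt (\<ge>) (replicate k (Suc N))"
        by (induction k) auto
      then show ?thesis
        using that *[OF \<mu>] \<open>m \<le> N\<close>
        by (fastforce simp: parts_at_most_twice_def sorted_wrt_append count_list_replicate)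
    qed
    then show ?case
      by auto
  next
    case 4
    show ?case
      by (auto simp: parts_at_most_twice_def sorted_wrt_filter count_list_filter)
  }
qed

lemma parts_at_most_twice_self: "parts_at_most_twice m m = {[]}"
  by (auto simp: parts_at_most_twice_def)

lemma finite_parts_at_most_twice: "m \<le> N \<Longrightarrow> finite (parts_at_most_twice m N)"
proof (induction N rule: dec_induct)
  case (step N)
  then show ?case
    using bij_betw_finite[OF bij_betw_prepend_largest[of m N]] by simp
qed (simp add: parts_at_most_twice_self)

lemma parts_at_most_twice_gf:
  fixes q w :: "'a::comm_ring_1"
  assumes "m \<le> N"
  shows "(\<Sum>\<mu>\<in>parts_at_most_twice m N. w ^ length \<mu> * q ^ sum_list \<mu>)
       = (\<Prod>j\<in>{m<..N}. 1 + w * q ^ j + w^2 * q ^ (2 * j))"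
  using assms
proof (induction N rule: dec_induct)
  case (step N)
  have "(\<Sum>\<mu>\<in>parts_at_most_twice m (Suc N). w ^ length \<mu> * q ^ sum_list \<mu>)
     = (\<Sum>(k, \<mu>)\<in>{..2} \<times> parts_at_most_twice m N.
          (w ^ k * q ^ (k * Suc N)) * (w ^ length \<mu> * q ^ sum_list \<mu>))"
    by (subst sum.reindex_bij_betw[OF bij_betw_prepend_largest[OF step(1)], symmetric])
      (auto intro!: sum.cong simp: power_add sum_list_replicate mult_ac)
  also have "\<dots> = (\<Sum>k\<le>2. w ^ k * q ^ (k * Suc N)) *
      (\<Sum>\<mu>\<in>parts_at_most_twice m N. w ^ length \<mu> * q ^ sum_list \<mu>)"
    by (simp only: sum_product sum.cartesian_product)
  also have "(\<Sum>k\<le>2. w ^ k * q ^ (k * Suc N)) = 1 + w * q ^ Suc N + w^2 * q ^ (2 * Suc N)"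
    by (simp add: eval_nat_numeral)
  also have "{m<..Suc N} = insert (Suc N) {m<..N}"
    using step(1) by auto
  ultimately show ?case
    using step.IH by (simp del: power_Suc)
qed (simp add: parts_at_most_twice_self)

section \<open>Cutting off the three smallest parts\<close>

lemma smallest_part_append:
  assumes "set \<mu> \<subseteq> {m<..}"
  shows "smallest_part (\<mu> @ replicate 3 m) = m"
  unfolding smallest_part_def using assms by (intro Min_eqI) (auto simp: less_imp_le)

lemma tau_append:
  assumes "set \<mu> \<subseteq> {m<..}"
  shows "tau (\<mu> @ replicate 3 m) = length \<mu>"
proof -
  have "filter (\<lambda>x. x > m) \<mu> = \<mu>"
    using assms by (auto simp: filter_id_conv)
  then show ?thesis
    by (simp add: tau_def smallest_part_append[OF assms])
qed

lemma partitions_D3_split: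
  assumes "\<nu> \<in> partitions_D3 n"
  shows "filter (\<lambda>x. x > smallest_part \<nu>) \<nu> @ replicate 3 (smallest_part \<nu>) = \<nu>"
proof -
  have "sorted_wrt (\<ge>) \<nu>" and count: "count_list \<nu> (smallest_part \<nu>) = 3"
    using assms by (simp_all add: partitions_D3_def is_partition_def)
  moreover have "smallest_part \<nu> \<le> x" if "x \<in> set \<nu>" for x
    using that by (simp add: smallest_part_def)
  ultimately show ?thesis
    using sorted_split_smallest[of \<nu> "smallest_part \<nu>"] unfolding count by metis
qed

text \<open>A partition is cut into its larger parts and the three copies of its smallest part
  \<open>m\<close>, where \<open>m = 0\<close> covers the partitions with zero parts. All parts are
  at most \<open>n\<close>, hence at most \<open>N\<close>.\<close>

lemma bij_betw_append_smallest:
  assumes "n \<le> N"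
  shows "bij_betw (\<lambda>(m, \<mu>). \<mu> @ replicate 3 m)
    {(m, \<mu>) \<in> (SIGMA m:{..N}. parts_at_most_twice m N). sum_list \<mu> + 3 * m = n} (partitions_D3 n)"
proof (rule bij_betw_byWitness[where
      f' = "\<lambda>\<nu>. (smallest_part \<nu>, filter (\<lambda>x. x > smallest_part \<nu>) \<nu>)"], goal_cases)
  case 1
  have "filter (\<lambda>x. x > m) \<mu> = \<mu>" if "\<mu> \<in> parts_at_most_twice m N" for m \<mu>
    using that by (auto simp: parts_at_most_twice_def filter_id_conv)
  moreover have "smallest_part (\<mu> @ replicate 3 m) = m" if "\<mu> \<in> parts_at_most_twice m N" for m \<mu>
    using that by (intro smallest_part_append) (auto simp: parts_at_most_twice_def)
  ultimately show ?case
    by auto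
next
  case 2
  show ?case
    by (simp add: partitions_D3_split)
next
  case 3
  show ?case
  proof clarify
    fix m \<mu> assume \<mu>: "\<mu> \<in> parts_at_most_twice m N" and n: "n = sum_list \<mu> + 3 * m"
    then have sub: "set \<mu> \<subseteq> {m<..}"
      by (auto simp: parts_at_most_twice_def)
    then have "count_list \<mu> m = 0"
      by (auto simp: count_list_0_iff)
    then show "\<mu> @ replicate 3 m \<in> partitions_D3 (sum_list \<mu> + 3 * m)"
      using \<mu> sub unfolding partitions_D3_def mem_Collect_eq smallest_part_append[OF sub]
      by (auto simp: parts_at_most_twice_def is_partition_def sorted_wrt_append
          count_list_replicate eval_nat_numeral less_imp_le)
  qed
next
  case 4
  show ?case
  proof (rule image_subsetI)
    fix \<nu> assume \<nu>: "\<nu> \<in> partitions_D3 n"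
    define s where "s = smallest_part \<nu>"
    have "sum_list \<nu> = sum_list (filter (\<lambda>x. x > s) \<nu>) + 3 * s"
      using arg_cong[OF partitions_D3_split[OF \<nu>], of sum_list]
      by (simp add: s_def sum_list_replicate)
    moreover have "sum_list \<nu> = n"
      using \<nu> by (simp add: partitions_D3_def)
    moreover have "x \<le> N" if "x \<in> set \<nu>" for x
      using member_le_sum_list[OF that] \<open>sum_list \<nu> = n\<close> assms by simp
    ultimately show "(smallest_part \<nu>, filter (\<lambda>x. x > smallest_part \<nu>) \<nu>) \<in>
        {(m, \<mu>) \<in> (SIGMA m:{..N}. parts_at_most_twice m N). sum_list \<mu> + 3 * m = n}"
      using \<nu> assms unfolding s_def[symmetric]
      by (auto simp: parts_at_most_twice_def sorted_wrt_filter count_list_filter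
          partitions_D3_def is_partition_def count_list_0_iff s_def)
  qed
qed

text \<open>The factor \<open>fps_X ^ (3 * m)\<close> accounts for the three smallest parts, and
  each larger part carries one \<open>w\<close>, so the power of \<open>w\<close> is
  \<open>tau\<close>.\<close>

lemma sum_power_tau:
  fixes w :: "'a::comm_ring_1"
  assumes "n \<le> N"
  shows "(\<Sum>\<nu>\<in>partitions_D3 n. w ^ tau \<nu>) = D3_series fps_X (fps_const w) N 3 $ n"
proof -
  define S where "S = (SIGMA m:{..N}. parts_at_most_twice m N)"
  have "finite S"
    unfolding S_def by (intro finite_SigmaI) (auto simp: finite_parts_at_most_twice)
  have "D3_series fps_X (fps_const w) N 3 =
      (\<Sum>m\<le>N. \<Sum>\<mu>\<in>parts_at_most_twice m N.
         fps_const w ^ length \<mu> * fps_X ^ (sum_list \<mu> + 3 * m))"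
    unfolding D3_series_def
  proof (rule sum.cong)
    fix m assume "m \<in> {..N}"
    then show "fps_X ^ (3 * m) * (\<Prod>j\<in>{m<..N}. 1 + fps_const w * fps_X ^ j + (fps_const w)^2 * fps_X ^ (2 * j))
        = (\<Sum>\<mu>\<in>parts_at_most_twice m N.
             fps_const w ^ length \<mu> * fps_X ^ (sum_list \<mu> + 3 * m))"
      by (simp only: parts_at_most_twice_gf[symmetric] atMost_iff)
        (simp only: sum_distrib_left power_add mult_ac)
  qed simp
  also have "\<dots> = (\<Sum>(m, \<mu>)\<in>S. fps_const w ^ length \<mu> * fps_X ^ (sum_list \<mu> + 3 * m))"
    unfolding S_def by (rule sum.Sigma) (auto simp: finite_parts_at_most_twice)
  finally have "D3_series fps_X (fps_const w) N 3 $ n =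
      (\<Sum>(m, \<mu>)\<in>S. if sum_list \<mu> + 3 * m = n then w ^ length \<mu> else 0)"
    by (auto simp: fps_sum_nth fps_const_power fps_X_power_nth intro!: sum.cong)
  also have "\<dots> = (\<Sum>(m, \<mu>)\<in>{(m, \<mu>) \<in> S. sum_list \<mu> + 3 * m = n}. w ^ length \<mu>)"
    using \<open>finite S\<close> by (intro sum.mono_neutral_cong_right) (auto split: if_splits)
  also have "\<dots> = (\<Sum>\<nu>\<in>partitions_D3 n. w ^ tau \<nu>)"
    unfolding S_def
  proof (subst sum.reindex_bij_betw[OF bij_betw_append_smallest[OF assms], symmetric], rule sum.cong)
    fix p assume "p \<in> {(m, \<mu>) \<in> (SIGMA m:{..N}. parts_at_most_twice m N). sum_list \<mu> + 3 * m = n}"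
    then obtain m \<mu> where p: "p = (m, \<mu>)" and "\<mu> \<in> parts_at_most_twice m N"
      by auto
    then have "set \<mu> \<subseteq> {m<..}"
      by (auto simp: parts_at_most_twice_def)
    then show "(case p of (m, \<mu>) \<Rightarrow> w ^ length \<mu>) =
        w ^ tau (case p of (m, \<mu>) \<Rightarrow> \<mu> @ replicate 3 m)"
      by (simp add: p tau_append)
  qed simp
  finally show ?thesis ..
qed

section \<open>Separating the residue classes\<close>

text \<open>Kept general in \<open>f\<close> and the semiring to serve both the complex sum of
  powers of \<open>w\<close> and the total count, where \<open>f\<close> is constantly 1.\<close>

lemma sum_residue_classes:
  fixes t :: "'a \<Rightarrow> nat" and f :: "nat \<Rightarrow> 'b::semiring_1"
  assumes "finite A"
  shows "(\<Sum>a\<in>A. f (t a mod 3)) = (\<Sum>i<3. of_nat (card {a \<in> A. [t a = i] (mod 3)}) * f i)"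
proof -
  have "(\<Sum>a\<in>A. f (t a mod 3)) = (\<Sum>i<3. \<Sum>a\<in>{a \<in> A. t a mod 3 = i}. f (t a mod 3))"
    using assms by (intro sum.group[symmetric]) auto
  also have "\<dots> = (\<Sum>i<3. of_nat (card {a \<in> A. [t a = i] (mod 3)}) * f i)"
    by (intro sum.cong) (auto simp: cong_def)
  finally show ?thesis .
qed

theorem theorem1p1:
  fixes n :: nat
  assumes "n \<ge> 1"
    and "\<forall>r::nat. n \<noteq> triangular r + 1"
  shows "D3_class 0 n = D3_class 1 n \<and> D3_class 1 n = D3_class 2 n \<and>
         real (D3_class 2 n) = real (D3 n) / 3"
proof -
  define w where "w = Complex (-1/2) (sqrt 3 / 2)"
  have w2: "w^2 = Complex (-1/2) (- (sqrt 3 / 2))"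
    by (simp add: w_def complex_eq_iff power2_eq_square)
  then have w: "1 + w + w^2 = 0"
    by (simp add: w_def complex_eq_iff)
  have "w^3 = w * w^2"
    by (simp add: power3_eq_cube power2_eq_square)
  then have w3: "w^3 = 1"
    unfolding w2 by (simp add: w_def complex_eq_iff)
  have wmod: "w ^ k = w ^ (k mod 3)" for k
  proof -
    have "w ^ k = w ^ (3 * (k div 3) + k mod 3)"
      by simp
    also have "\<dots> = w ^ (k mod 3)"
      by (simp only: power_add power_mult w3) simp
    finally show ?thesis .
  qed
  have classes: "(\<Sum>\<nu>\<in>partitions_D3 n. f (tau \<nu> mod 3)) =
      of_nat (D3_class 0 n) * f 0 + of_nat (D3_class 1 n) * f 1 + of_nat (D3_class 2 n) * f 2"
    for f :: "nat \<Rightarrow> 'b::semiring_1"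
    using sum_residue_classes[OF finite_partitions_D3, of f tau n]
    by (simp add: D3_class_def partitions_D3_class_def lessThan_nat_numeral lessThan_Suc add_ac)
  have "(\<Sum>\<nu>\<in>partitions_D3 n. w ^ (tau \<nu> mod 3)) = 0"
    unfolding wmod[symmetric] sum_power_tau[OF order.refl]
    using D3_series_three_nth[OF w] assms by simp
  then have "of_nat (D3_class 0 n) + of_nat (D3_class 1 n) * w + of_nat (D3_class 2 n) * w^2 = 0"
    using classes[of "\<lambda>i. w ^ i"] by simp
  \<comment> \<open>Real and imaginary parts of the vanishing sum.\<close>
  then have "real (D3_class 0 n) = (real (D3_class 1 n) + real (D3_class 2 n)) / 2"
    and "(real (D3_class 1 n) - real (D3_class 2 n)) * sqrt 3 = 0"
    unfolding w2 by (simp_all add: w_def complex_eq_iff field_simps)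
  then have eq: "D3_class 0 n = D3_class 1 n" "D3_class 1 n = D3_class 2 n"
    by simp_all
  have "D3 n = D3_class 0 n + D3_class 1 n + D3_class 2 n"
    using classes[of "\<lambda>_. 1 :: nat"] by (simp add: D3_def)
  with eq show ?thesis
    by simp
qed

end
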